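(* Let $D$ be a finite set with $|D|\ge 2$, let $\mathbb{P}_0=(p_{0s})_{s\in D}$ be a probability measure on $D$ with $p_{0s}>0$ for all $s$, and let $c\ge 1$ satisfy $c<\min_{s\in D}\frac{1}{1-p_{0s}}$. Let there be a single risky asset ($K=1$) with non-constant payoff $S:D\to\mathbb{R}$, and put $\underline S=\min_{s\in D}S_s$, $\overline S=\max_{s\in D}S_s$. Let $u$ be a strictly increasing, strictly concave, twice differentiable utility function satisfying the Inada conditions. Then for all $\alpha\in[0,1]$ and all prices $\pi\in(\underline S,\overline S)$, $$\lim_{\theta\uparrow\overline\Theta}V_\alpha'(\theta)=-\infty\qquad\text{and}\qquad\lim_{\theta\downarrow\underline\Theta}V_\alpha'(\theta)=+\infty .$$
   Context: With initial wealth $w_0$ and price $\pi$, $W^\theta=w_0+\theta(S-\pi)$ and $$V_\alpha(\theta)=\alpha\min_{P\in\mathcal{X}}\mathbb{E}_P[u(W^\theta)]+(1-\alpha)\max_{P\in\mathcal{X}}\mathbb{E}_P[u(W^\theta)],$$ where $\mathcal{X}=\{P: P(s)\ge 0\ \forall s\in D,\ \sum_{s}P(s)=1,\ \sum_{s}P(s)^2/p_{0s}\le c\}$. Two cases are considered. (1) $u$ is defined on all of $\mathbb{R}$: the admissible set is $\Theta=\mathbb{R}$, with $\underline\Theta=-\infty$, $\overline\Theta=+\infty$. (2) $u$ is defined only on $(0,\infty)$: $w_0>0$ and $\Theta=\{\theta\in\mathbb{R}: w_0+\theta(S_s-\pi)>0\ \forall s\in D\}$, with $\underline\Theta=-\frac{w_0}{\overline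 S-\pi}$, $\overline\Theta=\frac{w_0}{\pi-\underline S}$. Inada conditions: $\lim_{x\downarrow-\infty}u'(x)=+\infty$ in case (1), $\lim_{x\downarrow0}u'(x)=+\infty$ in case (2), and $\lim_{x\uparrow+\infty}u'(x)=0$ in both cases. *)

theory Defs
  imports "HOL-Analysis.Analysis"
begin

text \<open>Probability vectors on a finite state space \<open>D\<close> are functions on the type of states; their
  values outside \<open>D\<close> play no role.\<close>

definition prob_vector :: "'s set \<Rightarrow> ('s \<Rightarrow> real) \<Rightarrow> bool" where
  "prob_vector D P \<longleftrightarrow> (\<forall>s\<in>D. 0 \<le> P s) \<and> (\<Sum>s\<in>D. P s) = 1"

definition expect :: "'s set \<Rightarrow> ('s \<Rightarrow> real) \<Rightarrow> ('s \<Rightarrow> real) \<Rightarrow> real" where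
  "expect D P X = (\<Sum>s\<in>D. P s * X s)"

definition priors :: "'s set \<Rightarrow> ('s \<Rightarrow> real) \<Rightarrow> real \<Rightarrow> ('s \<Rightarrow> real) set" where
  "priors D p0 c = {P. prob_vector D P \<and> (\<Sum>s\<in>D. (P s)\<^sup>2 / p0 s) \<le> c}"

definition wealth :: "real \<Rightarrow> real \<Rightarrow> ('s \<Rightarrow> real) \<Rightarrow> real \<Rightarrow> 's \<Rightarrow> real" where
  "wealth w0 \<pi> S \<theta> s = w0 + \<theta> * (S s - \<pi>)"

text \<open>The infimum and the supremum below are a minimum and a maximum: see \<open>priors_attains\<close>.\<close>

definition alpha_maxmin ::
  "'s set \<Rightarrow> ('s \<Rightarrow> real) \<Rightarrow> real \<Rightarrow> (real \<Rightarrow> real) \<Rightarrow> real \<Rightarrow> real \<Rightarrow> ('s \<Rightarrow> real)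
    \<Rightarrow> real \<Rightarrow> real \<Rightarrow> real" where
  "alpha_maxmin D p0 c u w0 \<pi> S \<alpha> \<theta> =
     \<alpha> * (INF P\<in>priors D p0 c. expect D P (\<lambda>s. u (wealth w0 \<pi> S \<theta> s)))
     + (1 - \<alpha>) * (SUP P\<in>priors D p0 c. expect D P (\<lambda>s. u (wealth w0 \<pi> S \<theta> s)))"

definition strictly_concave_on :: "real set \<Rightarrow> (real \<Rightarrow> real) \<Rightarrow> bool" where
  "strictly_concave_on U u \<longleftrightarrow>
     (\<forall>x\<in>U. \<forall>y\<in>U. \<forall>t\<in>{0<..<1}. x \<noteq> y \<longrightarrow>
        (1 - t) * u x + t * u y < u ((1 - t) * x + t * y))"

definition twice_differentiable_on :: "real set \<Rightarrow> (real \<Rightarrow> real) \<Rightarrow> bool" where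
  "twice_differentiable_on U u \<longleftrightarrow>
     (\<forall>x\<in>U. u differentiable (at x) \<and> deriv u differentiable (at x))"

text \<open>The domain \<open>U\<close> of the utility function is either \<open>UNIV\<close> or \<open>{0<..}\<close>; in the latter case the
  values of \<open>u\<close> outside \<open>U\<close> are arbitrary and irrelevant.\<close>

definition inada :: "real set \<Rightarrow> (real \<Rightarrow> real) \<Rightarrow> bool" where
  "inada U u \<longleftrightarrow>
     filterlim (deriv u) at_top (if U = UNIV then at_bot else at_right 0) \<and>
     (deriv u \<longlongrightarrow> 0) at_top"

definition admissible ::
  "'s set \<Rightarrow> real set \<Rightarrow> real \<Rightarrow> real \<Rightarrow> ('s \<Rightarrow> real) \<Rightarrow> real set" where
  "admissible D U w0 \<pi> S = {\<theta>. \<forall>s\<in>D. wealth w0 \<pi> S \<theta> s \<in> U}"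

definition theta_lower ::
  "'s set \<Rightarrow> real set \<Rightarrow> real \<Rightarrow> real \<Rightarrow> ('s \<Rightarrow> real) \<Rightarrow> ereal" where
  "theta_lower D U w0 \<pi> S =
     (if U = UNIV then - \<infinity> else ereal (- (w0 / (Max (S ` D) - \<pi>))))"

definition theta_upper ::
  "'s set \<Rightarrow> real set \<Rightarrow> real \<Rightarrow> real \<Rightarrow> ('s \<Rightarrow> real) \<Rightarrow> ereal" where
  "theta_upper D U w0 \<pi> S =
     (if U = UNIV then \<infinity> else ereal (w0 / (\<pi> - Min (S ` D))))"

lemma admissible_iff:
  assumes D: "finite D" "D \<noteq> {}"
    and pi: "Min (S ` D) < \<pi>" "\<pi> < Max (S ` D)"
    and U: "U = UNIV \<or> (U = {0<..} \<and> 0 < w0)"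
  shows "\<theta> \<in> admissible D U w0 \<pi> S \<longleftrightarrow>
    theta_lower D U w0 \<pi> S < ereal \<theta> \<and> ereal \<theta> < theta_upper D U w0 \<pi> S"
proof (cases "U = UNIV")
  case True
  then show ?thesis by (simp add: admissible_def theta_lower_def theta_upper_def)
next
  case False
  with U have U: "U = {0<..}" and w0: "0 < w0" by auto
  let ?a = "Min (S ` D)" and ?b = "Max (S ` D)"
  have b: "?a \<le> S s" "S s \<le> ?b" if "s \<in> D" for s using D that by auto
  have "?a \<in> S ` D" "?b \<in> S ` D" using D by (auto intro!: Min_in Max_in)
  then obtain s1 s2 where s: "s1 \<in> D" "S s1 = ?a" "s2 \<in> D" "S s2 = ?b" by (metis imageE)
  have "(\<forall>s\<in>D. 0 < w0 + \<theta> * (S s - \<pi>)) \<longleftrightarrow> 0 < w0 + \<theta> * (?a - \<pi>) \<and> 0 < w0 + \<theta> * (?b - \<pi>)"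
  proof
    assume "\<forall>s\<in>D. 0 < w0 + \<theta> * (S s - \<pi>)"
    then show "0 < w0 + \<theta> * (?a - \<pi>) \<and> 0 < w0 + \<theta> * (?b - \<pi>)" using s by metis
  next
    assume *: "0 < w0 + \<theta> * (?a - \<pi>) \<and> 0 < w0 + \<theta> * (?b - \<pi>)"
    show "\<forall>s\<in>D. 0 < w0 + \<theta> * (S s - \<pi>)"
    proof
      fix s assume "s \<in> D"
      then have "\<theta> * (?a - \<pi>) \<le> \<theta> * (S s - \<pi>) \<or> \<theta> * (?b - \<pi>) \<le> \<theta> * (S s - \<pi>)"
        using b[of s] by (cases "\<theta> \<ge> 0") (auto intro: mult_left_mono mult_left_mono_neg)
      with * show "0 < w0 + \<theta> * (S s - \<pi>)" by linarith
    qed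
  qed
  also have "\<dots> \<longleftrightarrow> - (w0 / (?b - \<pi>)) < \<theta> \<and> \<theta> < w0 / (\<pi> - ?a)"
    using pi by (auto simp: field_simps)
  finally show ?thesis
    using False U by (simp add: admissible_def theta_lower_def theta_upper_def wealth_def)
qed

lemma priors_attains:
  fixes D :: "'s set"
  assumes D: "finite D" and p0: "prob_vector D p0" "\<And>s. s \<in> D \<Longrightarrow> 0 < p0 s" and c: "1 \<le> c"
  shows "\<exists>P\<in>priors D p0 c. expect D P X = (INF Q\<in>priors D p0 c. expect D Q X)"
    and "\<exists>P\<in>priors D p0 c. expect D P X = (SUP Q\<in>priors D p0 c. expect D Q X)"
proof -
  define E where "E = (\<lambda>P. expect D P X) ` priors D p0 c"
  define B where "B = PiE (UNIV :: 's set) (\<lambda>s. if s \<in> D then {0..1::real} else {0})"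
  define K where "K = B \<inter> ({P. (\<Sum>s\<in>D. P s) = 1} \<inter> {P. (\<Sum>s\<in>D. (P s)\<^sup>2 / p0 s) \<le> c})"
  have B: "compact B"
    using compactin_PiE[of "\<lambda>_::'s. euclidean :: real topology" UNIV
        "\<lambda>s. if s \<in> D then {0..1::real} else {0}"]
    by (simp add: B_def euclidean_product_topology)
  have cont: "continuous_on UNIV (\<lambda>P :: 's \<Rightarrow> real. P s)" for s
    by (simp add: continuous_on_product_coordinates)
  have "closed ({P. (\<Sum>s\<in>D. P s) = 1} \<inter> {P :: 's \<Rightarrow> real. (\<Sum>s\<in>D. (P s)\<^sup>2 / p0 s) \<le> c})"
    using p0(2) by (intro closed_Int closed_Collect_eq closed_Collect_le continuous_intros cont) force
  with B have K: "compact K" unfolding K_def by (rule compact_Int_closed)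
  have "continuous_on K (\<lambda>P. expect D P X)"
    unfolding expect_def by (intro continuous_intros continuous_on_subset[OF cont]) auto
  with K have "compact ((\<lambda>P. expect D P X) ` K)" by (rule compact_continuous_image[rotated])
  also have "(\<lambda>P. expect D P X) ` K = E"
  proof (intro subset_antisym subsetI)
    fix v assume "v \<in> (\<lambda>P. expect D P X) ` K"
    then obtain P where P: "P \<in> K" "v = expect D P X" by auto
    have "P s \<in> (if s \<in> D then {0..1} else {0})" for s
      using P(1) by (simp add: K_def B_def PiE_iff)
    then have "\<forall>s\<in>D. 0 \<le> P s" by (metis atLeastAtMost_iff)
    with P show "v \<in> E" by (auto simp: K_def E_def priors_def prob_vector_def)
  next
    fix v assume "v \<in> E"
    then obtain P where P: "P \<in> priors D p0 c" "v = expect D P X" by (auto simp: E_def)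
    let ?P = "\<lambda>s. if s \<in> D then P s else 0"
    have "P s \<le> 1" if "s \<in> D" for s
      using P(1) D that member_le_sum[of s D P] by (auto simp: priors_def prob_vector_def)
    moreover have "(\<Sum>s\<in>D. ?P s) = (\<Sum>s\<in>D. P s)"
      "(\<Sum>s\<in>D. (?P s)\<^sup>2 / p0 s) = (\<Sum>s\<in>D. (P s)\<^sup>2 / p0 s)" by (auto intro: sum.cong)
    ultimately have "?P \<in> K"
      using P(1) by (auto simp: K_def B_def priors_def prob_vector_def PiE_iff)
    moreover have "v = expect D ?P X" using P(2) by (auto simp: expect_def intro: sum.cong)
    ultimately show "v \<in> (\<lambda>P. expect D P X) ` K" by blast
  qed
  finally have E: "compact E" .
  have "(\<Sum>s\<in>D. (p0 s)\<^sup>2 / p0 s) = (\<Sum>s\<in>D. p0 s)"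
    using p0(2) by (intro sum.cong) (auto simp: power2_eq_square)
  then have "p0 \<in> priors D p0 c" using p0 c by (auto simp: priors_def prob_vector_def)
  then have "E \<noteq> {}" by (auto simp: E_def)
  with E have "Inf E \<in> E" "Sup E \<in> E"
    by (auto intro!: closed_contains_Inf closed_contains_Sup
        simp: compact_imp_closed compact_imp_bounded bounded_imp_bdd_above bounded_imp_bdd_below)
  then show "\<exists>P\<in>priors D p0 c. expect D P X = (INF Q\<in>priors D p0 c. expect D Q X)"
    and "\<exists>P\<in>priors D p0 c. expect D P X = (SUP Q\<in>priors D p0 c. expect D Q X)"
    by (auto simp: E_def)
qed

end

theory Submission
  imports Defs
begin

text \<open>Since \<open>c < 1 / (1 - p0 s)\<close>, the nonnegativity constraints never bind on the chi-square ball of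
  priors. Hence the extremal priors are the tilts \<open>p0 s (1 \<plusminus> sqrt (c - 1) (X s - m) / \<sigma>)\<close>, where \<open>m\<close>
  and \<open>\<sigma>\<close> are the mean and standard deviation of \<open>X\<close> under \<open>p0\<close>, and
  \<open>V = m + (1 - 2 \<alpha>) sqrt (c - 1) \<sigma>\<close> with \<open>X = u \<circ> W\<close>. For \<open>\<theta> \<noteq> 0\<close> this is differentiable, and its
  derivative is the expectation of \<open>u'(W) (S - \<pi>)\<close> under the tilt by \<open>(1 - 2 \<alpha>) sqrt (c - 1)\<close>. All
  weights of this tilt stay away from \<open>0\<close>, so as \<open>\<theta>\<close> increases to its bound the term of the worst
  state tends to \<open>- \<infinity>\<close>, whereas the positive terms have \<open>W \<ge> w0\<close> and stay bounded because \<open>u'\<close> is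
  decreasing. The lower end follows by the reflection \<open>(S, \<pi>, \<theta>) \<mapsto> (- S, - \<pi>, - \<theta>)\<close>.\<close>

section \<open>Mean, standard deviation and tilted weights on a finite probability space\<close>

definition std_dev :: "'s set \<Rightarrow> ('s \<Rightarrow> real) \<Rightarrow> ('s \<Rightarrow> real) \<Rightarrow> real" where
  "std_dev D p X = sqrt (expect D p (\<lambda>s. (X s - expect D p X)\<^sup>2))"

text \<open>For constant \<open>X\<close> the convention \<open>x / 0 = 0\<close> makes the tilt equal to \<open>p\<close> itself.\<close>

definition tilt :: "'s set \<Rightarrow> ('s \<Rightarrow> real) \<Rightarrow> real \<Rightarrow> ('s \<Rightarrow> real) \<Rightarrow> 's \<Rightarrow> real" where
  "tilt D p k X s = p s * (1 + k * (X s - expect D p X) / std_dev D p X)"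

lemma weighted_Cauchy_Schwarz:
  fixes p x y :: "'s \<Rightarrow> real"
  assumes "\<And>s. s \<in> A \<Longrightarrow> 0 \<le> p s"
  shows "(\<Sum>s\<in>A. p s * (x s * y s))\<^sup>2 \<le> (\<Sum>s\<in>A. p s * (x s)\<^sup>2) * (\<Sum>s\<in>A. p s * (y s)\<^sup>2)"
proof -
  have "(\<Sum>s\<in>A. p s * (x s * y s)) = (\<Sum>s\<in>A. (sqrt (p s) * x s) * (sqrt (p s) * y s))"
    using assms by (intro sum.cong) (auto simp: algebra_simps)
  moreover have "(\<Sum>s\<in>A. p s * (x s)\<^sup>2) = (\<Sum>s\<in>A. (sqrt (p s) * x s)\<^sup>2)" for x :: "'s \<Rightarrow> real"
    using assms by (intro sum.cong) (auto simp: power_mult_distrib)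
  ultimately show ?thesis
    using Cauchy_Schwarz_ineq_sum[of "\<lambda>s. sqrt (p s) * x s" "\<lambda>s. sqrt (p s) * y s" A] by simp
qed

context
  fixes D :: "'s set" and p :: "'s \<Rightarrow> real"
  assumes D: "finite D" and p: "prob_vector D p"
begin

lemma expect_centered: "(\<Sum>s\<in>D. p s * (X s - expect D p X)) = 0"
  using p by (simp add: right_diff_distrib sum_subtractf expect_def prob_vector_def
      flip: sum_distrib_right)

lemma std_dev_nonneg: "0 \<le> std_dev D p X"
  using p by (auto simp: std_dev_def expect_def prob_vector_def intro!: sum_nonneg)

lemma std_dev_squared: "(std_dev D p X)\<^sup>2 = (\<Sum>s\<in>D. p s * (X s - expect D p X)\<^sup>2)"
  using std_dev_nonneg[of X] by (simp add: std_dev_def) (simp add: expect_def)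

text \<open>Deviations from the mean cancel, so the other states, of total mass
  \<open>1 - p s\<close>, must compensate \<open>p s * Y s\<close>. Cauchy-Schwarz on
  \<open>D - {s}\<close> shows how much of the variance this costs.\<close>

lemma deviation_squared_le:
  assumes s: "s \<in> D"
  shows "p s * (X s - expect D p X)\<^sup>2 \<le> (1 - p s) * (std_dev D p X)\<^sup>2"
proof -
  define Y where "Y t = X t - expect D p X" for t
  have rest: "(\<Sum>t\<in>D - {s}. p t * Y t) = - (p s * Y s)"
    "(\<Sum>t\<in>D - {s}. p t * (Y t)\<^sup>2) = (std_dev D p X)\<^sup>2 - p s * (Y s)\<^sup>2"
    "(\<Sum>t\<in>D - {s}. p t) = 1 - p s"
    using D s p expect_centered[of X] std_dev_squared[of X]
    by (auto simp: sum_diff1 Y_def prob_vector_def)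
  have "(p s * Y s)\<^sup>2 \<le> ((std_dev D p X)\<^sup>2 - p s * (Y s)\<^sup>2) * (1 - p s)"
    using weighted_Cauchy_Schwarz[of "D - {s}" p Y "\<lambda>_. 1"] p rest by (auto simp: prob_vector_def)
  moreover have "(p s * Y s)\<^sup>2 + p s * (Y s)\<^sup>2 * (1 - p s) = p s * (Y s)\<^sup>2"
    by (simp add: power2_eq_square algebra_simps)
  ultimately show ?thesis by (simp add: Y_def algebra_simps)
qed

lemma sum_tilt: "(\<Sum>s\<in>D. tilt D p k X s) = 1"
proof -
  have "(\<Sum>s\<in>D. tilt D p k X s) =
      (\<Sum>s\<in>D. p s) + k / std_dev D p X * (\<Sum>s\<in>D. p s * (X s - expect D p X))"
    by (simp add: tilt_def sum_distrib_left flip: sum.distrib) (simp add: algebra_simps)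
  then show ?thesis using p by (simp add: expect_centered prob_vector_def)
qed

text \<open>The relative change of weight is \<open>k\<close> times the standardised
  \<open>X\<close>, whose covariance with \<open>X\<close> is the standard deviation.\<close>

lemma expect_tilt: "expect D (tilt D p k X) X = expect D p X + k * std_dev D p X"
proof -
  let ?m = "expect D p X" and ?d = "std_dev D p X"
  have "expect D (tilt D p k X) X =
      (\<Sum>s\<in>D. p s * X s + k / ?d * (p s * (X s - ?m)\<^sup>2) + k / ?d * ?m * (p s * (X s - ?m)))"
    unfolding expect_def[of D "tilt D p k X"]
  proof (intro sum.cong refl)
    fix s
    have "1 + k * (X s - ?m) / ?d = 1 + k / ?d * (X s - ?m)" by simp
    then show "tilt D p k X s * X s =
        p s * X s + k / ?d * (p s * (X s - ?m)\<^sup>2) + k / ?d * ?m * (p s * (X s - ?m))"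
      unfolding tilt_def by (simp only:) (simp only: power2_eq_square algebra_simps)
  qed
  also have "\<dots> = ?m + k / ?d * ?d\<^sup>2 + k / ?d * ?m * 0"
    unfolding sum.distrib sum_distrib_left[symmetric] expect_centered std_dev_squared
    by (simp add: expect_def)
  \<comment> \<open>Also valid for \<open>?d = 0\<close>, where both correction terms are
    zero.\<close>
  also have "\<dots> = ?m + k * ?d" by (simp add: power2_eq_square)
  finally show ?thesis .
qed

end

section \<open>Extremal expectations over the chi-square ball\<close>

locale chi_square_ball =
  fixes D :: "'s set" and p :: "'s \<Rightarrow> real" and c :: real
  assumes D: "finite D" and p: "prob_vector D p" and p_pos: "\<And>s. s \<in> D \<Longrightarrow> 0 < p s"
    and c: "1 \<le> c" and c_less: "\<And>s. s \<in> D \<Longrightarrow> c < 1 / (1 - p s)"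
begin

text \<open>If \<open>p s \<ge> 1\<close>, then \<open>1 / (1 - p s)\<close> is nonpositive or the junk value \<open>1 / 0 = 0\<close>.\<close>

lemma p_less_1:
  assumes "s \<in> D" shows "p s < 1"
proof (rule ccontr)
  assume "\<not> p s < 1"
  then have "1 / (1 - p s) \<le> 0" by (simp add: divide_le_0_iff)
  with c c_less[OF assms] show False by linarith
qed

text \<open>By \<open>deviation_squared_le\<close> a standardised deviation at \<open>s\<close> has
  square at most \<open>(1 - p s) / p s\<close>. The bound does not depend on \<open>X\<close>,
  hence it is uniform in \<theta> later.\<close>

lemma tilt_lower_bound:
  assumes s: "s \<in> D" and k: "\<bar>k\<bar> \<le> sqrt (c - 1)"
  shows "p s * (1 - sqrt ((c - 1) * (1 - p s) / p s)) \<le> tilt D p k X s"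
proof -
  define z where "z = (X s - expect D p X) / std_dev D p X"
  have "z\<^sup>2 \<le> (1 - p s) / p s"
  proof (cases "std_dev D p X = 0")
    case True
    then show ?thesis using p_pos[OF s] p_less_1[OF s] by (simp add: z_def)
  next
    case False
    then show ?thesis
      using deviation_squared_le[OF D p s, of X] p_pos[OF s]
      by (simp add: z_def power_divide divide_simps mult.commute)
  qed
  moreover have "k\<^sup>2 \<le> c - 1" using power_mono[OF k, of 2] c by simp
  ultimately have "k\<^sup>2 * z\<^sup>2 \<le> (c - 1) * ((1 - p s) / p s)" using c by (intro mult_mono) auto
  then have "\<bar>k * z\<bar> \<le> sqrt ((c - 1) * (1 - p s) / p s)"
    by (intro real_le_rsqrt) (simp add: power_mult_distrib)
  then have "1 - sqrt ((c - 1) * (1 - p s) / p s) \<le> 1 + k * z" by linarith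
  then show ?thesis using p_pos[OF s] by (simp add: tilt_def z_def)
qed

text \<open>The condition \<open>c * (1 - p s) < 1\<close> rearranges to
  \<open>(c - 1) * (1 - p s) < p s\<close>, which puts the square root below 1.\<close>

lemma tilt_lower_bound_pos:
  assumes s: "s \<in> D" shows "0 < p s * (1 - sqrt ((c - 1) * (1 - p s) / p s))"
proof -
  have "c * (1 - p s) < 1" using c_less[OF s] p_less_1[OF s] by (simp add: field_simps)
  then have "(c - 1) * (1 - p s) / p s < 1" using p_pos[OF s] by (simp add: field_simps)
  then show ?thesis using p_pos[OF s] by simp
qed

lemma tilt_pos:
  assumes "s \<in> D" "\<bar>k\<bar> \<le> sqrt (c - 1)" shows "0 < tilt D p k X s"
  using tilt_lower_bound[OF assms, of X] tilt_lower_bound_pos[OF assms(1)] by linarith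

lemma tilt_le_1:
  assumes "s \<in> D" "\<bar>k\<bar> \<le> sqrt (c - 1)" shows "tilt D p k X s \<le> 1"
proof -
  have "tilt D p k X s \<le> (\<Sum>t\<in>D. tilt D p k X t)"
    using assms D by (intro member_le_sum) (auto intro: less_imp_le[OF tilt_pos])
  then show ?thesis by (simp add: sum_tilt[OF D p])
qed

text \<open>With respect to \<open>p\<close>, the constraint thus confines the density
  \<open>P s / p s\<close> to an L2 ball of radius \<open>sqrt (c - 1)\<close> around 1.\<close>

lemma chi_square_divergence:
  assumes "prob_vector D P"
  shows "(\<Sum>s\<in>D. (P s)\<^sup>2 / p s) = 1 + (\<Sum>s\<in>D. p s * (P s / p s - 1)\<^sup>2)"
proof -
  have "(\<Sum>s\<in>D. (P s)\<^sup>2 / p s) = (\<Sum>s\<in>D. p s * (P s / p s - 1)\<^sup>2 + 2 * P s - p s)"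
    using p_pos by (intro sum.cong) (force simp: power2_eq_square field_simps)+
  then show ?thesis
    using assms p by (simp add: sum.distrib sum_subtractf prob_vector_def flip: sum_distrib_left)
qed

lemma tilt_in_priors:
  assumes k: "\<bar>k\<bar> \<le> sqrt (c - 1)"
  shows "tilt D p k X \<in> priors D p c"
proof -
  let ?d = "std_dev D p X"
  have prob: "prob_vector D (tilt D p k X)"
    using sum_tilt[OF D p] tilt_pos[OF _ k] by (force simp: prob_vector_def intro: less_imp_le)
  have "(\<Sum>s\<in>D. p s * (tilt D p k X s / p s - 1)\<^sup>2) =
      (\<Sum>s\<in>D. (k / ?d)\<^sup>2 * (p s * (X s - expect D p X)\<^sup>2))"
    using p_pos by (intro sum.cong) (force simp: tilt_def power_mult_distrib power_divide)+
  also have "\<dots> = (k / ?d)\<^sup>2 * ?d\<^sup>2"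
    by (simp add: std_dev_squared[OF D p] flip: sum_distrib_left)
  \<comment> \<open>An equality unless \<open>?d = 0\<close>, where the left side is 0.\<close>
  also have "\<dots> \<le> k\<^sup>2" by (cases "?d = 0") (auto simp: power_divide)
  also have "k\<^sup>2 \<le> c - 1" using power_mono[OF k, of 2] c by simp
  finally show ?thesis
    using prob chi_square_divergence[OF prob] by (simp add: priors_def)
qed

text \<open>The difference of the means is the inner product, under \<open>p\<close>, of
  \<open>P s / p s - 1\<close> with the centered \<open>X\<close>; Cauchy-Schwarz applies.\<close>

lemma expect_deviation_le:
  assumes P: "P \<in> priors D p c"
  shows "\<bar>expect D P X - expect D p X\<bar> \<le> sqrt (c - 1) * std_dev D p X"
proof -
  let ?m = "expect D p X"
  have prob: "prob_vector D P" and le: "(\<Sum>s\<in>D. p s * (P s / p s - 1)\<^sup>2) \<le> c - 1"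
    using P chi_square_divergence[of P] by (auto simp: priors_def)
  have "(\<Sum>s\<in>D. p s * ((P s / p s - 1) * (X s - ?m))) =
      (\<Sum>s\<in>D. P s * X s - ?m * P s - p s * (X s - ?m))"
    using p_pos by (intro sum.cong) (force simp: field_simps)+
  also have "\<dots> = expect D P X - ?m"
    using prob expect_centered[OF D p, of X]
    by (simp add: sum_subtractf expect_def[of D P] prob_vector_def flip: sum_distrib_left)
  finally have "(expect D P X - ?m)\<^sup>2 \<le> (\<Sum>s\<in>D. p s * (P s / p s - 1)\<^sup>2) * (std_dev D p X)\<^sup>2"
    using weighted_Cauchy_Schwarz[of D p "\<lambda>s. P s / p s - 1" "\<lambda>s. X s - ?m"] p
    by (simp add: std_dev_squared[OF D p] prob_vector_def)
  also have "\<dots> \<le> (c - 1) * (std_dev D p X)\<^sup>2" using le by (intro mult_right_mono) auto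
  finally have "\<bar>expect D P X - ?m\<bar> \<le> sqrt ((c - 1) * (std_dev D p X)\<^sup>2)"
    by (intro real_le_rsqrt) simp
  then show ?thesis using std_dev_nonneg[OF D p, of X] by (simp add: real_sqrt_mult)
qed

text \<open>The bound of \<open>expect_deviation_le\<close> is attained by the tilt with
  \<open>k = sqrt (c - 1)\<close>; the infimum uses the opposite sign.\<close>

lemma SUP_priors: "(SUP P\<in>priors D p c. expect D P X) = expect D p X + sqrt (c - 1) * std_dev D p X"
proof (rule cSup_eq_maximum)
  show "expect D p X + sqrt (c - 1) * std_dev D p X \<in> (\<lambda>P. expect D P X) ` priors D p c"
    using tilt_in_priors[of "sqrt (c - 1)" X] expect_tilt[OF D p, of "sqrt (c - 1)" X] c
    by (intro image_eqI[of _ _ "tilt D p (sqrt (c - 1)) X"]) auto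
qed (use expect_deviation_le[of _ X] in \<open>force simp: abs_le_iff\<close>)

lemma INF_priors: "(INF P\<in>priors D p c. expect D P X) = expect D p X - sqrt (c - 1) * std_dev D p X"
proof (rule cInf_eq_minimum)
  show "expect D p X - sqrt (c - 1) * std_dev D p X \<in> (\<lambda>P. expect D P X) ` priors D p c"
    using tilt_in_priors[of "- sqrt (c - 1)" X] expect_tilt[OF D p, of "- sqrt (c - 1)" X] c
    by (intro image_eqI[of _ _ "tilt D p (- sqrt (c - 1)) X"]) auto
qed (use expect_deviation_le[of _ X] in \<open>force simp: abs_le_iff\<close>)

lemma alpha_maxmin_eq:
  "alpha_maxmin D p c u w0 \<pi> S \<alpha> \<theta> =
    expect D p (\<lambda>s. u (wealth w0 \<pi> S \<theta> s))
    + (1 - 2 * \<alpha>) * sqrt (c - 1) * std_dev D p (\<lambda>s. u (wealth w0 \<pi> S \<theta> s))"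
  by (simp add: alpha_maxmin_def SUP_priors INF_priors algebra_simps)

text \<open>Guarantees that the square root in the standard deviation is differentiated away from
  0.\<close>

lemma std_dev_pos:
  assumes "s \<in> D" "t \<in> D" "X s \<noteq> X t"
  shows "0 < std_dev D p X"
proof (rule ccontr)
  assume "\<not> 0 < std_dev D p X"
  then have "std_dev D p X = 0" using std_dev_nonneg[OF D p, of X] by simp
  then have "(\<Sum>s\<in>D. p s * (X s - expect D p X)\<^sup>2) = 0" using std_dev_squared[OF D p, of X] by simp
  then have "\<forall>s\<in>D. p s * (X s - expect D p X)\<^sup>2 = 0"
    using D p_pos by (subst (asm) sum_nonneg_eq_0_iff) (auto simp: less_imp_le)
  then have "\<forall>s\<in>D. X s = expect D p X" using p_pos by fastforce
  then show False using assms by simp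
qed

text \<open>An envelope formula: the derivative is that of the expectation with the tilt frozen at
  \<open>x\<close>.\<close>

lemma DERIV_expect_plus_std_dev:
  assumes f: "\<And>s. s \<in> D \<Longrightarrow> (f s has_real_derivative f' s) (at x)"
    and pos: "0 < std_dev D p (\<lambda>s. f s x)"
  shows "((\<lambda>y. expect D p (\<lambda>s. f s y) + k * std_dev D p (\<lambda>s. f s y)) has_real_derivative
    expect D (tilt D p k (\<lambda>s. f s x)) f') (at x)"
proof -
  define m where "m y = expect D p (\<lambda>s. f s y)" for y
  define v where "v y = (\<Sum>s\<in>D. p s * (f s y - m y)\<^sup>2)" for y
  let ?d = "std_dev D p (\<lambda>s. f s x)" and ?m' = "expect D p f'"
  have d: "std_dev D p (\<lambda>s. f s y) = sqrt (v y)" for y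
    by (simp add: std_dev_def v_def m_def expect_def)
  have vx: "0 < v x" using pos by (simp add: d)
  have m': "(m has_real_derivative ?m') (at x)"
    unfolding m_def expect_def by (intro DERIV_sum DERIV_cmult f)
  have "(v has_real_derivative (\<Sum>s\<in>D. p s * (2 * (f s x - m x) * (f' s - ?m')))) (at x)"
    unfolding v_def
    by (intro DERIV_sum DERIV_cmult) (auto intro!: derivative_eq_intros f m')
  also have "(\<Sum>s\<in>D. p s * (2 * (f s x - m x) * (f' s - ?m'))) =
      2 * (\<Sum>s\<in>D. p s * (f s x - m x) * f' s) - 2 * ?m' * (\<Sum>s\<in>D. p s * (f s x - m x))"
    by (simp add: sum_distrib_left algebra_simps sum_subtractf sum.distrib)
  \<comment> \<open>The derivative of the mean drops out because the deviations are
    centered.\<close>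
  also have "\<dots> = 2 * (\<Sum>s\<in>D. p s * (f s x - m x) * f' s)"
    using expect_centered[OF D p, of "\<lambda>s. f s x"] by (simp add: m_def)
  finally have "((\<lambda>y. m y + k * sqrt (v y)) has_real_derivative
      ?m' + k * ((\<Sum>s\<in>D. p s * (f s x - m x) * f' s) / ?d)) (at x)"
    using m' vx unfolding d by (auto intro!: derivative_eq_intros simp: field_simps)
  moreover have "?m' + k * ((\<Sum>s\<in>D. p s * (f s x - m x) * f' s) / ?d) =
      expect D (tilt D p k (\<lambda>s. f s x)) f'"
    unfolding expect_def[of D p f'] expect_def[of D "tilt D p k (\<lambda>s. f s x)"]
      sum_divide_distrib sum_distrib_left sum.distrib[symmetric]
    using pos by (intro sum.cong refl) (simp add: tilt_def m_def field_simps)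
  ultimately show ?thesis by (simp add: d m_def)
qed

end

section \<open>Sign and monotonicity of marginal utility, and a bound on its weighted mean\<close>

lemma deriv_strict_mono_nonneg:
  fixes u :: "real \<Rightarrow> real"
  assumes mono: "strict_mono_on U u" and "open U" "x \<in> U" and "u differentiable (at x)"
  shows "0 \<le> deriv u x"
proof (rule ccontr)
  assume "\<not> 0 \<le> deriv u x"
  moreover have "(u has_real_derivative deriv u x) (at x)"
    using assms(4) by (simp add: DERIV_deriv_iff_real_differentiable)
  ultimately obtain e where e: "0 < e" "\<And>h. 0 < h \<Longrightarrow> h < e \<Longrightarrow> u (x + h) < u x"
    using DERIV_neg_dec_right[of u "deriv u x" x] by auto
  obtain r where r: "0 < r" "ball x r \<subseteq> U" using assms(2,3) by (meson openE)
  let ?h = "min e r / 2"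
  have "x + ?h \<in> U" using e(1) r by (intro subsetD[OF r(2)]) (auto simp: dist_real_def)
  then have "u x < u (x + ?h)" using mono \<open>x \<in> U\<close> e(1) r(1) by (auto simp: strict_mono_on_def)
  moreover have "u (x + ?h) < u x" using e r(1) by (intro e(2)) auto
  ultimately show False by simp
qed

text \<open>Adding the tangent inequalities of the convex function \<open>- u\<close> at
  \<open>x\<close> and at \<open>y\<close> gives
  \<open>(deriv u x - deriv u y) * (y - x) \<ge> 0\<close>.\<close>

lemma deriv_concave_antimono:
  fixes u :: "real \<Rightarrow> real"
  assumes conc: "strictly_concave_on U u" and U: "open U" "convex U"
    and diff: "\<And>x. x \<in> U \<Longrightarrow> u differentiable (at x)"
    and xy: "x \<in> U" "y \<in> U" "x \<le> y"
  shows "deriv u y \<le> deriv u x"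
proof (cases "x = y")
  case False
  have conv: "convex_on U (\<lambda>x. - u x)"
  proof (rule convex_onI)
    fix t x y :: real assume "0 < t" "t < 1" "x \<in> U" "y \<in> U"
    then show "- u ((1 - t) *\<^sub>R x + t *\<^sub>R y) \<le> (1 - t) * - u x + t * - u y"
      using conc by (cases "x = y") (force simp: strictly_concave_on_def algebra_simps)+
  qed (fact U)
  have tangent: "- u b \<ge> - u a + - deriv u a * (b - a)" if "a \<in> U" "b \<in> U" for a b
  proof -
    have "((\<lambda>x. - u x) has_real_derivative - deriv u a) (at a within U)"
      using diff[OF that(1)]
      by (metis DERIV_deriv_iff_real_differentiable DERIV_minus has_field_derivative_at_within)
    moreover have "a \<in> interior U" using that U by (simp add: interior_open)
    ultimately have "- u b - - u a \<ge> - deriv u a * (b - a)"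
      using convex_on_imp_above_tangent[OF conv convex_connected[OF U(2)]] that by blast
    then show ?thesis by linarith
  qed
  have "(deriv u x - deriv u y) * (y - x) \<ge> 0"
    using tangent[OF xy(1,2)] tangent[OF xy(2,1)] by (simp add: algebra_simps)
  then show ?thesis using False xy(3) by (simp add: zero_le_mult_iff)
qed simp

text \<open>Here \<open>d\<close> is the excess payoff and \<mu> the marginal utility. Gains are
  capped by \<open>M\<close>, losses in states other than \<open>s\<close> are dropped, and the loss
  at \<open>s\<close> keeps at least the weight \<epsilon>.\<close>

lemma expect_marginal_le:
  assumes D: "finite D" "s \<in> D"
    and Q: "\<And>t. t \<in> D \<Longrightarrow> 0 \<le> Q t" "\<And>t. t \<in> D \<Longrightarrow> Q t \<le> 1" and \<epsilon>: "\<epsilon> \<le> Q s"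
    and \<mu>: "\<And>t. t \<in> D \<Longrightarrow> 0 \<le> \<mu> t" "\<And>t. t \<in> D \<Longrightarrow> 0 \<le> d t \<Longrightarrow> \<mu> t \<le> M"
    and M: "0 \<le> M" and ds: "d s \<le> 0"
  shows "expect D Q (\<lambda>t. \<mu> t * d t) \<le> M * (\<Sum>t\<in>D. \<bar>d t\<bar>) + \<epsilon> * d s * \<mu> s"
proof -
  have bound: "Q t * (\<mu> t * d t) \<le> M * \<bar>d t\<bar>" if t: "t \<in> D" for t
  proof (cases "0 \<le> d t")
    case True
    then have "Q t * (\<mu> t * d t) \<le> 1 * (M * d t)"
      using Q \<mu> t by (intro mult_mono mult_right_mono) auto
    then show ?thesis using True by simp
  next
    case False
    then have "Q t * (\<mu> t * d t) \<le> 0"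
      using Q \<mu> t by (intro mult_nonneg_nonpos) (auto intro: mult_nonneg_nonpos)
    then show ?thesis using M by (simp add: order_trans[OF _ mult_nonneg_nonneg])
  qed
  have "expect D Q (\<lambda>t. \<mu> t * d t) = Q s * (\<mu> s * d s) + (\<Sum>t\<in>D - {s}. Q t * (\<mu> t * d t))"
    unfolding expect_def using D by (rule sum.remove)
  also have "Q s * (\<mu> s * d s) \<le> \<epsilon> * (\<mu> s * d s)"
    using \<epsilon> \<mu>(1)[OF D(2)] ds by (intro mult_right_mono_neg) (auto intro: mult_nonneg_nonpos)
  also have "(\<Sum>t\<in>D - {s}. Q t * (\<mu> t * d t)) \<le> (\<Sum>t\<in>D - {s}. M * \<bar>d t\<bar>)"
    using bound by (intro sum_mono) auto
  also have "\<dots> \<le> (\<Sum>t\<in>D. M * \<bar>d t\<bar>)" using D M by (intro sum_mono2) auto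
  finally show ?thesis by (simp add: sum_distrib_left algebra_simps)
qed

section \<open>Behaviour at the upper end of the admissible interval\<close>

definition upper_end :: "real set \<Rightarrow> real \<Rightarrow> real \<Rightarrow> real filter" where
  "upper_end U w0 b = (if U = UNIV then at_top else at_left (w0 / b))"

lemma eventually_upper_end:
  assumes "U = UNIV \<or> U = {0<..} \<and> 0 < w0" and b: "0 < b"
  shows "\<forall>\<^sub>F \<theta> in upper_end U w0 b. 0 < \<theta> \<and> w0 - \<theta> * b \<in> U"
proof (cases "U = UNIV")
  case True
  then show ?thesis by (simp add: upper_end_def eventually_gt_at_top)
next
  case False
  with assms have U: "U = {0<..}" "0 < w0" by auto
  have "\<forall>\<^sub>F \<theta> in at_left (w0 / b). \<theta> \<in> {0<..<w0 / b}"
    using U b by (intro eventually_at_left_real) simp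
  then show ?thesis
    using False U b by (auto simp: upper_end_def field_simps elim!: eventually_mono)
qed

text \<open>The wealth \<open>w0 - \<theta> * b\<close> of the worst state falls to the lower end of
  \<open>U\<close>, where the first Inada condition applies.\<close>

lemma filterlim_deriv_upper_end:
  assumes "U = UNIV \<or> U = {0<..} \<and> 0 < w0" and b: "0 < b" and "inada U u"
  shows "filterlim (\<lambda>\<theta>. deriv u (w0 - \<theta> * b)) at_top (upper_end U w0 b)"
proof -
  let ?G = "if U = UNIV then at_bot else at_right (0::real)"
  have "filterlim (\<lambda>\<theta>. w0 - \<theta> * b) ?G (upper_end U w0 b)"
  proof (cases "U = UNIV")
    case True
    have "filterlim (\<lambda>\<theta>. - w0 + b * \<theta>) at_top at_top"
      using b
      by (intro filterlim_tendsto_add_at_top[OF tendsto_const]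
          filterlim_tendsto_pos_mult_at_top[OF tendsto_const] filterlim_ident)
    then show ?thesis
      using True by (simp add: upper_end_def filterlim_uminus_at_bot mult.commute)
  next
    case False
    have "((\<lambda>\<theta>. w0 - \<theta> * b) \<longlongrightarrow> w0 - w0 / b * b) (at_left (w0 / b))"
      by (intro tendsto_intros)
    \<comment> \<open>Convergence along \<open>at_right 0\<close> also requires approach from
      strictly above.\<close>
    moreover have "\<forall>\<^sub>F \<theta> in at_left (w0 / b). w0 - \<theta> * b \<in> {0<..} \<and> w0 - \<theta> * b \<noteq> 0"
      using eventually_upper_end[OF assms(1,2)] False assms(1)
      by (auto simp: upper_end_def elim!: eventually_mono)
    ultimately show ?thesis
      using False b by (auto simp: upper_end_def filterlim_at)
  qed
  moreover have "filterlim (deriv u) at_top ?G" using assms(3) by (simp add: inada_def)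
  ultimately show ?thesis by (rule filterlim_compose[rotated])
qed

context chi_square_ball
begin

text \<open>The lowest-payoff state \<open>s\<close> drives the divergence, while \<open>r\<close>
  ensures that utility varies across states. Payoffs and price are left general so that the
  reflected asset is covered too.\<close>

lemma alpha_maxmin_upper_end:
  assumes U: "U = UNIV \<or> U = {0<..} \<and> 0 < w0"
    and mono: "strict_mono_on U u" and conc: "strictly_concave_on U u"
    and diff: "twice_differentiable_on U u" and "inada U u" and \<alpha>: "\<alpha> \<in> {0..1}"
    and s: "s \<in> D" "\<And>t. t \<in> D \<Longrightarrow> S s \<le> S t" "S s < \<pi>" and r: "r \<in> D" "\<pi> < S r"
  shows "\<exists>g. (\<forall>\<^sub>F \<theta> in upper_end U w0 (\<pi> - S s).
      (alpha_maxmin D p c u w0 \<pi> S \<alpha> has_real_derivative g \<theta>) (at \<theta>)) \<and>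
    filterlim g at_bot (upper_end U w0 (\<pi> - S s))"
proof -
  define k where "k = (1 - 2 * \<alpha>) * sqrt (c - 1)"
  define W where "W = wealth w0 \<pi> S"
  define Q where "Q \<theta> = tilt D p k (\<lambda>t. u (W \<theta> t))" for \<theta>
  define g where "g \<theta> = expect D (Q \<theta>) (\<lambda>t. deriv u (W \<theta> t) * (S t - \<pi>))" for \<theta>
  \<comment> \<open>The \<theta>-independent floor for the weight of \<open>s\<close> from
    \<open>tilt_lower_bound\<close>.\<close>
  define \<epsilon> where "\<epsilon> = p s * (1 - sqrt ((c - 1) * (1 - p s) / p s))"
  define A where "A = deriv u w0 * (\<Sum>t\<in>D. \<bar>S t - \<pi>\<bar>)"
  let ?F = "upper_end U w0 (\<pi> - S s)"
  have "\<bar>1 - 2 * \<alpha>\<bar> * sqrt (c - 1) \<le> 1 * sqrt (c - 1)"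
    using \<alpha> c by (intro mult_right_mono) auto
  then have k: "\<bar>k\<bar> \<le> sqrt (c - 1)" using c by (simp add: k_def abs_mult)
  have oc: "open U" "convex U" and up: "\<And>x y. x \<in> U \<Longrightarrow> x \<le> y \<Longrightarrow> y \<in> U" and w0: "w0 \<in> U"
    using U by auto
  have du: "u differentiable (at x)" if "x \<in> U" for x
    using diff that by (simp add: twice_differentiable_on_def)
  have W: "W \<theta> t \<in> U" if "0 < \<theta>" "w0 - \<theta> * (\<pi> - S s) \<in> U" "t \<in> D" for \<theta> t
  proof (rule up[OF that(2)])
    have "\<theta> * (S s - \<pi>) \<le> \<theta> * (S t - \<pi>)" using that s(2) by (intro mult_left_mono) auto
    then show "w0 - \<theta> * (\<pi> - S s) \<le> W \<theta> t" by (simp add: W_def wealth_def algebra_simps)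
  qed
  have ev: "\<forall>\<^sub>F \<theta> in ?F. 0 < \<theta> \<and> w0 - \<theta> * (\<pi> - S s) \<in> U"
    using U s(3) by (intro eventually_upper_end) auto
  have "(alpha_maxmin D p c u w0 \<pi> S \<alpha> has_real_derivative g \<theta>) (at \<theta>)"
    if \<theta>: "0 < \<theta>" "w0 - \<theta> * (\<pi> - S s) \<in> U" for \<theta>
  proof -
    have "((\<lambda>\<theta>. u (W \<theta> t)) has_real_derivative deriv u (W \<theta> t) * (S t - \<pi>)) (at \<theta>)"
      if t: "t \<in> D" for t
    proof (rule DERIV_chain2[of u])
      show "(u has_real_derivative deriv u (W \<theta> t)) (at (W \<theta> t))"
        using du[OF W[OF \<theta> t]] by (simp add: DERIV_deriv_iff_real_differentiable)
      show "((\<lambda>\<theta>. W \<theta> t) has_real_derivative S t - \<pi>) (at \<theta>)"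
        by (auto simp: W_def wealth_def intro!: derivative_eq_intros)
    qed
    \<comment> \<open>Since \<theta> is positive, wealth separates \<open>s\<close> from
      \<open>r\<close>, which makes the standard deviation positive.\<close>
    moreover have "W \<theta> s < W \<theta> r" using \<theta>(1) s(3) r(2) by (simp add: W_def wealth_def)
    then have "u (W \<theta> s) \<noteq> u (W \<theta> r)"
      using mono W[OF \<theta> s(1)] W[OF \<theta> r(1)] by (force simp: strict_mono_on_def)
    then have "0 < std_dev D p (\<lambda>t. u (W \<theta> t))" by (rule std_dev_pos[OF s(1) r(1)])
    ultimately have "((\<lambda>\<theta>. expect D p (\<lambda>t. u (W \<theta> t)) + k * std_dev D p (\<lambda>t. u (W \<theta> t)))
        has_real_derivative g \<theta>) (at \<theta>)"
      unfolding g_def Q_def by (rule DERIV_expect_plus_std_dev)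
    then show ?thesis by (simp add: k_def W_def flip: alpha_maxmin_eq)
  qed
  with ev have "\<forall>\<^sub>F \<theta> in ?F. (alpha_maxmin D p c u w0 \<pi> S \<alpha> has_real_derivative g \<theta>) (at \<theta>)"
    by (auto elim: eventually_mono)
  moreover have "filterlim g at_bot ?F"
  proof (rule filterlim_at_bot_mono)
    have "0 < \<epsilon> * (\<pi> - S s)" using tilt_lower_bound_pos[OF s(1)] s(3) by (simp add: \<epsilon>_def)
    then have "filterlim (\<lambda>\<theta>. - A + \<epsilon> * (\<pi> - S s) * deriv u (w0 - \<theta> * (\<pi> - S s))) at_top ?F"
      using U s(3) \<open>inada U u\<close>
      by (intro filterlim_tendsto_add_at_top[OF tendsto_const]
          filterlim_tendsto_pos_mult_at_top[OF tendsto_const] filterlim_deriv_upper_end) auto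
    then show "filterlim (\<lambda>\<theta>. A + \<epsilon> * (S s - \<pi>) * deriv u (W \<theta> s)) at_bot ?F"
      by (simp add: filterlim_uminus_at_bot W_def wealth_def algebra_simps)
    show "\<forall>\<^sub>F \<theta> in ?F. g \<theta> \<le> A + \<epsilon> * (S s - \<pi>) * deriv u (W \<theta> s)"
      using ev
    proof (rule eventually_mono, elim conjE)
      fix \<theta> assume \<theta>: "0 < \<theta>" "w0 - \<theta> * (\<pi> - S s) \<in> U"
      \<comment> \<open>For \<theta> positive and \<open>S t \<ge> \<pi>\<close>, wealth is at least
        \<open>w0\<close>, so \<open>deriv u w0\<close> serves as the cap \<open>M\<close>.\<close>
      have "deriv u (W \<theta> t) \<le> deriv u w0" if "t \<in> D" "0 \<le> S t - \<pi>" for t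
        using that \<theta> W[OF \<theta>] w0
        by (intro deriv_concave_antimono[OF conc oc du]) (auto simp: W_def wealth_def)
      then show "g \<theta> \<le> A + \<epsilon> * (S s - \<pi>) * deriv u (W \<theta> s)"
        unfolding g_def A_def
        using D s W[OF \<theta>] k w0 du
        by (intro expect_marginal_le)
          (auto simp: Q_def \<epsilon>_def tilt_le_1 tilt_lower_bound intro!: less_imp_le[OF tilt_pos]
            deriv_strict_mono_nonneg[OF mono oc(1)])
    qed
  qed
  ultimately show ?thesis by blast
qed

end

section \<open>Reflection to the lower end and passage to extended real limits\<close>

lemma alpha_maxmin_reflect:
  "alpha_maxmin D p c u w0 (- \<pi>) (\<lambda>s. - S s) \<alpha> \<theta> = alpha_maxmin D p c u w0 \<pi> S \<alpha> (- \<theta>)"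
proof -
  have "wealth w0 (- \<pi>) (\<lambda>s. - S s) \<theta> = wealth w0 \<pi> S (- \<theta>)"
    by (rule ext) (simp add: wealth_def algebra_simps)
  then show ?thesis by (simp add: alpha_maxmin_def)
qed

lemma at_left_theta_upper:
  "at_left (theta_upper D U w0 \<pi> S) = filtermap ereal (upper_end U w0 (\<pi> - Min (S ` D)))"
  by (simp add: theta_upper_def upper_end_def at_left_PInf at_left_ereal)

lemma at_right_theta_lower:
  "at_right (theta_lower D U w0 \<pi> S) =
    filtermap ereal (filtermap uminus (upper_end U w0 (Max (S ` D) - \<pi>)))"
  using at_right_minus[of "- (w0 / (Max (S ` D) - \<pi>))"]
  by (simp add: theta_lower_def upper_end_def at_right_MInf at_right_ereal at_bot_mirror)

lemma deriv_filterlim_cong: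
  assumes "\<forall>\<^sub>F x in F. (V has_real_derivative g x) (at x)" and "filterlim g G F"
  shows "\<forall>\<^sub>F x in F. V differentiable (at x)" and "filterlim (deriv V) G F"
proof -
  show "\<forall>\<^sub>F x in F. V differentiable (at x)"
    using assms(1) by (rule eventually_mono) (auto simp: real_differentiable_def)
  have "\<forall>\<^sub>F x in F. g x = deriv V x"
    using assms(1) by (rule eventually_mono) (metis DERIV_imp_deriv)
  then show "filterlim (deriv V) G F"
    using assms(2) by (simp cong: filterlim_cong)
qed

theorem lemma2p7:
  fixes D :: "'s set" and p0 S :: "'s \<Rightarrow> real" and u :: "real \<Rightarrow> real" and U :: "real set"
    and c w0 \<pi> \<alpha> :: real
  assumes "finite D" and "2 \<le> card D"
    and "prob_vector D p0" and "\<And>s. s \<in> D \<Longrightarrow> 0 < p0 s"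
    and "1 \<le> c" and "c < Min ((\<lambda>s. 1 / (1 - p0 s)) ` D)"
    and "\<not> S constant_on D"
    and "U = UNIV \<or> (U = {0<..} \<and> 0 < w0)"
    and "strict_mono_on U u" and "strictly_concave_on U u" and "twice_differentiable_on U u"
    and "inada U u"
    and "\<alpha> \<in> {0..1}" and "\<pi> \<in> {Min (S ` D)<..<Max (S ` D)}"
  defines "V \<equiv> alpha_maxmin D p0 c u w0 \<pi> S \<alpha>"
    and "\<theta>\<^sub>l \<equiv> theta_lower D U w0 \<pi> S" and "\<theta>\<^sub>u \<equiv> theta_upper D U w0 \<pi> S"
  shows "((\<forall>\<^sub>F \<theta> in at_left \<theta>\<^sub>u. V differentiable at (real_of_ereal \<theta>)) \<and>
          filterlim (deriv V \<circ> real_of_ereal) at_bot (at_left \<theta>\<^sub>u)) \<and>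
         ((\<forall>\<^sub>F \<theta> in at_right \<theta>\<^sub>l. V differentiable at (real_of_ereal \<theta>)) \<and>
          filterlim (deriv V \<circ> real_of_ereal) at_top (at_right \<theta>\<^sub>l))"
proof -
  have D: "finite D" by fact
  have ne: "D \<noteq> {}" using assms(2) by auto
  interpret chi_square_ball D p0 c
    using assms(1,3,4,5,6) ne by unfold_locales auto
  have "Min (S ` D) \<in> S ` D" "Max (S ` D) \<in> S ` D" using D ne by auto
  then obtain a b where a: "a \<in> D" "S a = Min (S ` D)" and b: "b \<in> D" "S b = Max (S ` D)"
    by (metis imageE)
  have \<pi>: "S a < \<pi>" "\<pi> < S b" using assms(14) a b by auto
  have le: "S a \<le> S t" "S t \<le> S b" if "t \<in> D" for t using a b D that by auto
  let ?Fu = "upper_end U w0 (\<pi> - S a)" and ?Fl = "upper_end U w0 (S b - \<pi>)"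
  obtain g where g: "\<forall>\<^sub>F \<theta> in ?Fu. (V has_real_derivative g \<theta>) (at \<theta>)" "filterlim g at_bot ?Fu"
    using alpha_maxmin_upper_end[OF assms(8-13) a(1) le(1) \<pi>(1) b(1) \<pi>(2)] unfolding V_def by blast
  \<comment> \<open>Under reflection \<open>b\<close> becomes the worst state, and \<open>a\<close>
    the state paying more than the price.\<close>
  have "\<exists>h. (\<forall>\<^sub>F \<theta> in upper_end U w0 (- \<pi> - - S b).
      (alpha_maxmin D p0 c u w0 (- \<pi>) (\<lambda>s. - S s) \<alpha> has_real_derivative h \<theta>) (at \<theta>)) \<and>
    filterlim h at_bot (upper_end U w0 (- \<pi> - - S b))"
    using le(2) \<pi> by (intro alpha_maxmin_upper_end[OF assms(8-13) b(1) _ _ a(1)]) auto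
  then obtain h where h: "\<forall>\<^sub>F \<theta> in ?Fl. ((\<lambda>\<theta>. V (- \<theta>)) has_real_derivative h \<theta>) (at \<theta>)"
    "filterlim h at_bot ?Fl"
    unfolding alpha_maxmin_reflect[abs_def] V_def[symmetric] by auto
  \<comment> \<open>The chain rule for negation flips the sign of the derivative, turning the limit
    \<open>at_bot\<close> into \<open>at_top\<close>.\<close>
  have "\<forall>\<^sub>F \<theta> in filtermap uminus ?Fl. (V has_real_derivative - h (- \<theta>)) (at \<theta>)"
    unfolding eventually_filtermap using h(1)
    by (rule eventually_mono) (simp add: DERIV_mirror)
  moreover have "filterlim (\<lambda>\<theta>. - h (- \<theta>)) at_top (filtermap uminus ?Fl)"
    using h(2) by (simp add: filterlim_filtermap filterlim_uminus_at_bot)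
  ultimately have lower: "\<forall>\<^sub>F \<theta> in filtermap uminus ?Fl. V differentiable (at \<theta>)"
    "filterlim (deriv V) at_top (filtermap uminus ?Fl)"
    by (rule deriv_filterlim_cong)+
  note upper = deriv_filterlim_cong[OF g]
  show ?thesis
    using upper lower unfolding \<theta>\<^sub>l_def \<theta>\<^sub>u_def at_left_theta_upper at_right_theta_lower
    by (simp add: eventually_filtermap filterlim_filtermap a b o_def)
qed

end
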